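(* Let $(\mathcal{J},\diamond)$ be a finite-dimensional Jacobi-Jordan (JJ) algebra over a field $\mathbb{K}$ of characteristic different from $2$ and $3$, and suppose that there is a JJ algebra structure $\bullet$ on its dual space $\mathcal{J}^*$. Then there is a double construction of a symmetric JJ algebra associated to $(\mathcal{J},\diamond)$ and $(\mathcal{J}^*,\bullet)$ if and only if $(\mathcal{J},\mathcal{J}^*,L^*_\diamond,L^*_\bullet)$ is a matched pair of JJ algebras.
   Context: A JJ algebra $(\mathcal{J},\diamond)$ is a vector space with a bilinear product satisfying $x\diamond y=y\diamond x$ and $(x\diamond y)\diamond z+(z\diamond x)\diamond y+(y\diamond z)\diamond x=0$. A representation of a JJ algebra $(\mathcal{J},\diamond)$ on $V$ is a linear map $\rho:\mathcal{J}\to\operatorname{End}(V)$ with $\rho(x\diamond y)=-\rho(x)\rho(y)-\rho(y)\rho(x)$. Matched pair of JJ algebras: for JJ algebras $(\mathcal{G},\diamond)$, $(\mathcal{H},\bullet)$ and representations $\rho:\mathcal{G}\to\mathfrak{gl}(\mathcal{H})$, $\mu:\mathcal{H}\to\mathfrak{gl}(\mathcal{G})$, the tuple $(\mathcal{G},\mathcal{H},\rho,\mu)$ is a matched pair if for all $x,y\in\mathcal{G}$, $a,b\in\mathcal{H}$: $\rho(x)(a\bullet b)+\rho(x)a\bullet b+a\bullet\rho(x)b+\rho(\mu(a)x)b+\rho(\mu(b)x)a=0$ and $\mu(a)(x\diamond y)+\mu(a)x\diamond y+x\diamond\mu(a)y+\mu(\rho(x)a)y+\mu(\rho(y)a)x=0$.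 $L_\diamond(x)y=x\diamond y$, and $L^*_\diamond:\mathcal{J}\to\mathfrak{gl}(\mathcal{J}^* )$ is defined by $\langle L^*_\diamond(x)u^*,v\rangle=\langle u^*,L_\diamond(x)v\rangle$; similarly $L^*_\bullet:\mathcal{J}^*\to\mathfrak{gl}(\mathcal{J})$ using $\mathcal{J}^{**}=\mathcal{J}$. A double construction of a symmetric JJ algebra associated to $(\mathcal{J},\diamond)$ and $(\mathcal{J}^*,\bullet)$ is a JJ algebra structure $\ast$ on the vector space $\mathcal{J}\oplus\mathcal{J}^*$ such that $(\mathcal{J},\diamond)$ and $(\mathcal{J}^*,\bullet)$ are JJ subalgebras and the natural non-degenerate symmetric bilinear form $B(x+a^*,y+b^* )=\langle x,b^*\rangle+\langle a^*,y\rangle$ is invariant, i.e. $B(u\ast v,w)=B(u,v\ast w)$ for all $u,v,w\in\mathcal{J}\oplus\mathcal{J}^*$. *)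

theory Defs
  imports "HOL-Analysis.Product_Vector" "HOL-Library.Function_Algebras"
begin

text \<open>
  The dual of a vector space of type \<open>'v\<close> is a proper subset of the function type \<open>'v \<Rightarrow> 'k\<close>,
  so algebras and representations are formulated on subspaces of an ambient vector space.
  What a product or an action does outside those subspaces is left unconstrained.
\<close>

definition linear_between ::
  "('k::field \<Rightarrow> 'a::ab_group_add \<Rightarrow> 'a) \<Rightarrow> 'a set \<Rightarrow> ('k \<Rightarrow> 'b::ab_group_add \<Rightarrow> 'b) \<Rightarrow> 'b set \<Rightarrow>
    ('a \<Rightarrow> 'b) \<Rightarrow> bool"
  where "linear_between s1 V s2 W f \<longleftrightarrow>
    (\<forall>x\<in>V. f x \<in> W) \<and>
    (\<forall>x\<in>V. \<forall>y\<in>V. f (x + y) = f x + f y) \<and>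
    (\<forall>c. \<forall>x\<in>V. f (s1 c x) = s2 c (f x))"

locale jj_algebra = vector_space s
  for s :: "'k::field \<Rightarrow> 'v::ab_group_add \<Rightarrow> 'v" (infixr \<open>*s\<close> 75) +
  fixes V :: "'v set"
    and mult :: "'v \<Rightarrow> 'v \<Rightarrow> 'v" (infixl \<open>\<diamondop>\<close> 70)
  assumes subspace_carrier: "subspace V"
    and mult_linear_left: "y \<in> V \<Longrightarrow> linear_between s V s V (\<lambda>x. x \<diamondop> y)"
    and mult_linear_right: "x \<in> V \<Longrightarrow> linear_between s V s V (\<lambda>y. x \<diamondop> y)"
    and mult_commute: "x \<in> V \<Longrightarrow> y \<in> V \<Longrightarrow> x \<diamondop> y = y \<diamondop> x"
    and jacobi: "x \<in> V \<Longrightarrow> y \<in> V \<Longrightarrow> z \<in> V \<Longrightarrow>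
      (x \<diamondop> y) \<diamondop> z + (z \<diamondop> x) \<diamondop> y + (y \<diamondop> z) \<diamondop> x = 0"

locale jj_representation =
  G: jj_algebra scaleG G mult + W: vector_space scaleW
  for scaleG :: "'k::field \<Rightarrow> 'g::ab_group_add \<Rightarrow> 'g"
    and G :: "'g set"
    and mult :: "'g \<Rightarrow> 'g \<Rightarrow> 'g" (infixl \<open>\<diamondop>\<close> 70)
    and scaleW :: "'k \<Rightarrow> 'w::ab_group_add \<Rightarrow> 'w" +
  fixes W :: "'w set"
    and \<rho> :: "'g \<Rightarrow> 'w \<Rightarrow> 'w"
  assumes subspace_module: "W.subspace W"
    and endomorphism: "x \<in> G \<Longrightarrow> linear_between scaleW W scaleW W (\<rho> x)"
    and action_linear: "v \<in> W \<Longrightarrow> linear_between scaleG G scaleW W (\<lambda>x. \<rho> x v)"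
    and action_mult: "x \<in> G \<Longrightarrow> y \<in> G \<Longrightarrow> v \<in> W \<Longrightarrow>
      \<rho> (x \<diamondop> y) v = - \<rho> x (\<rho> y v) - \<rho> y (\<rho> x v)"

locale jj_matched_pair =
  G: jj_algebra scaleG G multG + H: jj_algebra scaleH H multH +
  \<rho>: jj_representation scaleG G multG scaleH H \<rho> +
  \<mu>: jj_representation scaleH H multH scaleG G \<mu>
  for scaleG :: "'k::field \<Rightarrow> 'g::ab_group_add \<Rightarrow> 'g"
    and G :: "'g set"
    and multG :: "'g \<Rightarrow> 'g \<Rightarrow> 'g" (infixl \<open>\<diamondop>\<close> 70)
    and scaleH :: "'k \<Rightarrow> 'h::ab_group_add \<Rightarrow> 'h"
    and H :: "'h set"
    and multH :: "'h \<Rightarrow> 'h \<Rightarrow> 'h" (infixl \<open>\<bullet>\<close> 70)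
    and \<rho> :: "'g \<Rightarrow> 'h \<Rightarrow> 'h"
    and \<mu> :: "'h \<Rightarrow> 'g \<Rightarrow> 'g" +
  assumes compatible_H: "x \<in> G \<Longrightarrow> a \<in> H \<Longrightarrow> b \<in> H \<Longrightarrow>
      \<rho> x (a \<bullet> b) + \<rho> x a \<bullet> b + a \<bullet> \<rho> x b + \<rho> (\<mu> a x) b + \<rho> (\<mu> b x) a = 0"
    and compatible_G: "a \<in> H \<Longrightarrow> x \<in> G \<Longrightarrow> y \<in> G \<Longrightarrow>
      \<mu> a (x \<diamondop> y) + \<mu> a x \<diamondop> y + x \<diamondop> \<mu> a y + \<mu> (\<rho> x a) y + \<mu> (\<rho> y a) x = 0"

definition dual :: "('k::field \<Rightarrow> 'v::ab_group_add \<Rightarrow> 'v) \<Rightarrow> ('v \<Rightarrow> 'k) set"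
  where "dual s = {u. Vector_Spaces.linear s (*) u}"

definition scale_dual :: "'k::field \<Rightarrow> ('v \<Rightarrow> 'k) \<Rightarrow> 'v \<Rightarrow> 'k"
  where "scale_dual c u = (\<lambda>v. c * u v)"

definition Lstar :: "('v \<Rightarrow> 'v \<Rightarrow> 'v) \<Rightarrow> 'v \<Rightarrow> ('v \<Rightarrow> 'k) \<Rightarrow> 'v \<Rightarrow> 'k"
  where "Lstar mult x u = (\<lambda>v. u (mult x v))"

text \<open>
  The functional on the dual whose value at \<open>b\<close> is \<open>\<langle>x, multD a b\<rangle>\<close> is identified with a vector
  through the canonical map into the bidual; in finite dimension there is exactly one such
  vector, see \<open>Lstar_dual_unique\<close> below.
\<close>

definition Lstar_dual ::
  "('k::field \<Rightarrow> 'v::ab_group_add \<Rightarrow> 'v) \<Rightarrow> (('v \<Rightarrow> 'k) \<Rightarrow> ('v \<Rightarrow> 'k) \<Rightarrow> 'v \<Rightarrow> 'k) \<Rightarrow>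
    ('v \<Rightarrow> 'k) \<Rightarrow> 'v \<Rightarrow> 'v"
  where "Lstar_dual s multD a x = (THE y. \<forall>b\<in>dual s. b y = multD a b x)"

definition double_form :: "'v \<times> ('v \<Rightarrow> 'k::field) \<Rightarrow> 'v \<times> ('v \<Rightarrow> 'k) \<Rightarrow> 'k"
  where "double_form u w = snd w (fst u) + snd u (fst w)"

definition double_construction ::
  "('k::field \<Rightarrow> 'v::ab_group_add \<Rightarrow> 'v) \<Rightarrow> ('v \<Rightarrow> 'v \<Rightarrow> 'v) \<Rightarrow>
    (('v \<Rightarrow> 'k) \<Rightarrow> ('v \<Rightarrow> 'k) \<Rightarrow> 'v \<Rightarrow> 'k) \<Rightarrow>
    ('v \<times> ('v \<Rightarrow> 'k) \<Rightarrow> 'v \<times> ('v \<Rightarrow> 'k) \<Rightarrow> 'v \<times> ('v \<Rightarrow> 'k)) \<Rightarrow> bool"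
  where "double_construction s mult multD m \<longleftrightarrow>
    (let D = UNIV \<times> dual s in
      jj_algebra (module_prod.scale s scale_dual) D m \<and>
      (\<forall>x y. m (x, 0) (y, 0) = (mult x y, 0)) \<and>
      (\<forall>a\<in>dual s. \<forall>b\<in>dual s. m (0, a) (0, b) = (0, multD a b)) \<and>
      (\<forall>u\<in>D. \<forall>v\<in>D. \<forall>w\<in>D. double_form (m u v) w = double_form u (m v w)))"

lemma vector_space_scale_dual: "vector_space (scale_dual :: 'k::field \<Rightarrow> ('v \<Rightarrow> 'k) \<Rightarrow> 'v \<Rightarrow> 'k)"
  by unfold_locales (auto simp: scale_dual_def fun_eq_iff algebra_simps)

lemma vector_space_field_mult: "vector_space ((*) :: 'k::field \<Rightarrow> 'k \<Rightarrow> 'k)"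
  by unfold_locales (auto simp: algebra_simps)

lemma dual_iff:
  assumes "vector_space s"
  shows "u \<in> dual s \<longleftrightarrow> (\<forall>x y. u (x + y) = u x + u y) \<and> (\<forall>c x. u (s c x) = c * u x)"
  using assms vector_space_field_mult by (auto simp: dual_def Vector_Spaces.linear_iff)

lemma subspace_dual:
  assumes "vector_space s"
  shows "module.subspace scale_dual (dual s)"
proof -
  interpret d: vector_space "scale_dual :: 'a \<Rightarrow> ('b \<Rightarrow> 'a) \<Rightarrow> 'b \<Rightarrow> 'a"
    by (rule vector_space_scale_dual)
  show ?thesis
    by (simp add: d.subspace_def dual_iff[OF assms] scale_dual_def distrib_left add_ac mult.left_commute)
qed

lemma reflexive:
  assumes fd: "finite_dimensional_vector_space s B"
    and F: "linear_between scale_dual (dual s) (*) UNIV F"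
  shows "\<exists>!y. \<forall>b\<in>dual s. b y = F b"
proof -
  interpret finite_dimensional_vector_space s B by fact
  interpret d: vector_space "scale_dual :: 'a \<Rightarrow> ('b \<Rightarrow> 'a) \<Rightarrow> 'b \<Rightarrow> 'a"
    by (rule vector_space_scale_dual)
  note sub = subspace_dual[OF vector_space_axioms]
  define e where "e i = (\<lambda>v. representation B v i)" for i
  have e: "e i \<in> dual s" for i
    unfolding dual_iff[OF vector_space_axioms] e_def
    by (simp add: independent_Basis span_Basis representation_add representation_scale)
  have expand: "v = (\<Sum>i\<in>B. s (e i v) i)" for v
    unfolding e_def using sum_representation_eq[OF independent_Basis, of v B] finite_Basis span_Basis
    by simp
  have app: "b v = (\<Sum>i\<in>B. e i v * b i)" if b: "b \<in> dual s" for b v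
  proof -
    interpret b: Vector_Spaces.linear s "(*)" b
      using b by (simp add: dual_def)
    have "b v = b (\<Sum>i\<in>B. s (e i v) i)"
      by (rule arg_cong[OF expand])
    also have "\<dots> = (\<Sum>i\<in>B. e i v * b i)"
      by (simp add: b.sum b.scale)
    finally show ?thesis .
  qed
  have F0: "F 0 = 0"
  proof -
    have "F (scale_dual 0 0) = 0 * F 0"
      using F d.subspace_0[OF sub] unfolding linear_between_def by blast
    then show ?thesis by simp
  qed
  have Fsum: "F (\<Sum>i\<in>S. scale_dual (c i) (e i)) = (\<Sum>i\<in>S. c i * F (e i))" if "finite S" for S c
    using that
  proof induction
    case empty
    show ?case by (simp only: sum.empty F0)
  next
    case (insert x S)
    have mem: "scale_dual (c x) (e x) \<in> dual s" "(\<Sum>i\<in>S. scale_dual (c i) (e i)) \<in> dual s"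
      using e sub by (auto intro!: d.subspace_sum d.subspace_scale)
    have "F (scale_dual (c x) (e x) + (\<Sum>i\<in>S. scale_dual (c i) (e i))) =
      F (scale_dual (c x) (e x)) + F (\<Sum>i\<in>S. scale_dual (c i) (e i))"
      using F mem unfolding linear_between_def by blast
    moreover have "F (scale_dual (c x) (e x)) = c x * F (e x)"
      using F e unfolding linear_between_def by blast
    ultimately show ?case
      using insert.IH by (simp only: sum.insert[OF insert.hyps])
  qed
  have sum_app: "(\<Sum>i\<in>S. scale_dual (c i) (e i)) v = (\<Sum>i\<in>S. c i * e i v)" if "finite S" for S c v
    using that by induction (simp_all add: scale_dual_def)
  define y where "y = (\<Sum>i\<in>B. s (F (e i)) i)"
  have "b y = F b" if b: "b \<in> dual s" for b
  proof -
    interpret b: Vector_Spaces.linear s "(*)" b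
      using b by (simp add: dual_def)
    have "b = (\<Sum>i\<in>B. scale_dual (b i) (e i))"
    proof
      fix v
      have "b v = (\<Sum>i\<in>B. b i * e i v)"
        by (subst app[OF b]) (simp add: mult.commute)
      then show "b v = (\<Sum>i\<in>B. scale_dual (b i) (e i)) v"
        by (simp only: sum_app[OF finite_Basis])
    qed
    then have "F b = F (\<Sum>i\<in>B. scale_dual (b i) (e i))"
      by (rule arg_cong)
    also have "\<dots> = (\<Sum>i\<in>B. b i * F (e i))"
      by (rule Fsum[OF finite_Basis])
    also have "\<dots> = b y"
      by (simp add: y_def b.sum b.scale mult.commute)
    finally show ?thesis by simp
  qed
  moreover have "z = y" if "\<forall>b\<in>dual s. b z = F b" for z
  proof -
    have "e i z = e i y" for i
      using that calculation e by simp
    then have "(\<Sum>i\<in>B. s (e i z) i) = (\<Sum>i\<in>B. s (e i y) i)"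
      by simp
    then show ?thesis
      by (simp only: expand[symmetric])
  qed
  ultimately show ?thesis by blast
qed

lemma Lstar_dual_unique:
  assumes fd: "finite_dimensional_vector_space s B"
    and D: "jj_algebra scale_dual (dual s) multD"
    and a: "a \<in> dual s"
  shows "\<exists>!y. \<forall>b\<in>dual s. b y = multD a b x"
proof (rule reflexive[OF fd])
  have "linear_between scale_dual (dual s) scale_dual (dual s) (multD a)"
    using jj_algebra.mult_linear_right[OF D a] by simp
  then show "linear_between scale_dual (dual s) (*) UNIV (\<lambda>b. multD a b x)"
    by (auto simp: linear_between_def scale_dual_def)
qed

end

theory Submission
  imports Defs
begin

text \<open>
  Both directions pass through the bicrossed product on \<open>G \<times> H\<close>: it is a JJ algebra exactly when
  the data form a matched pair, since the two components of the Jacobi identity on mixed triples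
  \<open>(x, y, a)\<close> and \<open>(x, a, b)\<close> are the representation and the compatibility conditions. Invariance of
  the natural form determines the mixed products of a double construction: pairing \<open>x \<ast> a\<close> with
  vectors and with functionals gives \<open>x \<ast> a = (L\<^sup>*(a) x, L\<^sup>*(x) a)\<close>.
\<close>

section \<open>Linearity on subspaces and componentwise scaling on a product space\<close>

lemma linear_betweenI:
  assumes "\<And>x. x \<in> V \<Longrightarrow> f x \<in> W"
    and "\<And>x y. x \<in> V \<Longrightarrow> y \<in> V \<Longrightarrow> f (x + y) = f x + f y"
    and "\<And>c x. x \<in> V \<Longrightarrow> f (s1 c x) = s2 c (f x)"
  shows "linear_between s1 V s2 W f"
  using assms by (simp add: linear_between_def)

lemma linear_betweenD:
  assumes "linear_between s1 V s2 W f" and "x \<in> V"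
  shows "f x \<in> W" and "y \<in> V \<Longrightarrow> f (x + y) = f x + f y" and "f (s1 c x) = s2 c (f x)"
  using assms by (auto simp: linear_between_def)

lemma module_prod_scale:
  fixes s1 :: "'k::field \<Rightarrow> 'a::ab_group_add \<Rightarrow> 'a" and s2 :: "'k \<Rightarrow> 'b::ab_group_add \<Rightarrow> 'b"
  assumes "vector_space s1" and "vector_space s2"
  shows "module_prod.scale s1 s2 c u = (s1 c (fst u), s2 c (snd u))"
proof -
  interpret v1: vector_space s1 by fact
  interpret v2: vector_space s2 by fact
  interpret p: module_prod s1 s2 ..
  show ?thesis by (cases u) (simp add: p.scale_def)
qed

lemma vector_space_module_prod:
  fixes s1 :: "'k::field \<Rightarrow> 'a::ab_group_add \<Rightarrow> 'a" and s2 :: "'k \<Rightarrow> 'b::ab_group_add \<Rightarrow> 'b"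
  assumes "vector_space s1" and "vector_space s2"
  shows "vector_space (module_prod.scale s1 s2)"
proof -
  interpret v1: vector_space s1 by fact
  interpret v2: vector_space s2 by fact
  interpret vector_space_prod s1 s2 ..
  show ?thesis by (rule p.vector_space_axioms)
qed

text \<open>This is the commutative product on the direct sum in which each factor acts on the
  other. Exchanging \<open>(multG, \<mu>)\<close> with \<open>(multH, \<rho>)\<close> swaps the two
  components, so any statement about the first yields one about the second.\<close>

definition bicrossed_mult ::
  "('g::ab_group_add \<Rightarrow> 'g \<Rightarrow> 'g) \<Rightarrow> ('h::ab_group_add \<Rightarrow> 'h \<Rightarrow> 'h) \<Rightarrow>
    ('g \<Rightarrow> 'h \<Rightarrow> 'h) \<Rightarrow> ('h \<Rightarrow> 'g \<Rightarrow> 'g) \<Rightarrow> 'g \<times> 'h \<Rightarrow> 'g \<times> 'h \<Rightarrow> 'g \<times> 'h"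
  where "bicrossed_mult multG multH \<rho> \<mu> u v =
    (multG (fst u) (fst v) + \<mu> (snd u) (fst v) + \<mu> (snd v) (fst u),
     multH (snd u) (snd v) + \<rho> (fst u) (snd v) + \<rho> (fst v) (snd u))"

section \<open>Bilinearity rules on the carriers, with the zero laws obtained by scaling by
  0\<close>

context jj_algebra
begin

lemma mult_closed: "x \<in> V \<Longrightarrow> y \<in> V \<Longrightarrow> x \<diamondop> y \<in> V"
  using linear_betweenD(1)[OF mult_linear_left] .

lemma mult_add_left: "x \<in> V \<Longrightarrow> y \<in> V \<Longrightarrow> z \<in> V \<Longrightarrow> (x + y) \<diamondop> z = x \<diamondop> z + y \<diamondop> z"
  using linear_betweenD(2)[OF mult_linear_left] .

lemma mult_add_right: "x \<in> V \<Longrightarrow> y \<in> V \<Longrightarrow> z \<in> V \<Longrightarrow> z \<diamondop> (x + y) = z \<diamondop> x + z \<diamondop> y"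
  using linear_betweenD(2)[OF mult_linear_right] .

lemma mult_scale_left: "x \<in> V \<Longrightarrow> y \<in> V \<Longrightarrow> (c *s x) \<diamondop> y = c *s (x \<diamondop> y)"
  using linear_betweenD(3)[OF mult_linear_left] .

lemma mult_scale_right: "x \<in> V \<Longrightarrow> y \<in> V \<Longrightarrow> x \<diamondop> (c *s y) = c *s (x \<diamondop> y)"
  using linear_betweenD(3)[OF mult_linear_right] .

lemma mult_zero_right: "x \<in> V \<Longrightarrow> x \<diamondop> 0 = 0"
  using mult_scale_right[of x x 0] by simp

lemma mult_zero_left: "x \<in> V \<Longrightarrow> 0 \<diamondop> x = 0"
  using mult_scale_left[of x x 0] by simp

end

context jj_representation
begin

lemma act_closed: "x \<in> G \<Longrightarrow> v \<in> W \<Longrightarrow> \<rho> x v \<in> W"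
  using linear_betweenD(1)[OF endomorphism] .

lemma act_add: "x \<in> G \<Longrightarrow> v \<in> W \<Longrightarrow> w \<in> W \<Longrightarrow> \<rho> x (v + w) = \<rho> x v + \<rho> x w"
  using linear_betweenD(2)[OF endomorphism] .

lemma act_scale: "x \<in> G \<Longrightarrow> v \<in> W \<Longrightarrow> \<rho> x (scaleW c v) = scaleW c (\<rho> x v)"
  using linear_betweenD(3)[OF endomorphism] .

lemma act_add_left: "x \<in> G \<Longrightarrow> y \<in> G \<Longrightarrow> v \<in> W \<Longrightarrow> \<rho> (x + y) v = \<rho> x v + \<rho> y v"
  using linear_betweenD(2)[OF action_linear] .

lemma act_scale_left: "x \<in> G \<Longrightarrow> v \<in> W \<Longrightarrow> \<rho> (scaleG c x) v = scaleW c (\<rho> x v)"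
  using linear_betweenD(3)[OF action_linear] .

lemma act_zero: "x \<in> G \<Longrightarrow> \<rho> x 0 = 0"
  using act_scale[of x 0 0] W.subspace_0[OF subspace_module] by simp

lemma act_zero_left: "v \<in> W \<Longrightarrow> \<rho> 0 v = 0"
  using act_scale_left[of 0 v 0] G.subspace_0[OF G.subspace_carrier] by simp

end

text \<open>In the expansion of the Jacobi sum, the pure terms cancel by the Jacobi identity of \<open>G\<close>, the
  terms with one element of \<open>H\<close> by compatibility, and those with two because \<open>\<mu>\<close> is a
  representation. The second component is the same statement for the opposite matched pair.\<close>

lemma (in jj_matched_pair) bicrossed_jacobi_fst:
  assumes [simp]: "x \<in> G" "y \<in> G" "z \<in> G" "a \<in> H" "b \<in> H" "c \<in> H"
  defines "m \<equiv> bicrossed_mult multG multH \<rho> \<mu>"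
  shows "fst (m (m (x, a) (y, b)) (z, c) + m (m (z, c) (x, a)) (y, b) + m (m (y, b) (z, c)) (x, a)) = 0"
proof -
  note [simp] = G.mult_closed H.mult_closed \<rho>.act_closed \<mu>.act_closed
    G.subspace_add[OF G.subspace_carrier] H.subspace_add[OF H.subspace_carrier]
  have rep: "\<mu> (p \<bullet> q) t + \<mu> p (\<mu> q t) + \<mu> q (\<mu> p t) = 0" if "p \<in> H" "q \<in> H" "t \<in> G" for p q t
    using \<mu>.action_mult[OF that] by simp
  \<comment> \<open>The product \<open>t \<diamondop> \<mu> p r\<close> is commuted because the
    Jacobi sum is nested to the left, so the image under \<open>\<mu>\<close> always expands as the
    left factor.\<close>
  have comp: "\<mu> p (t \<diamondop> r) + \<mu> p t \<diamondop> r + \<mu> p r \<diamondop> t + \<mu> (\<rho> t p) r + \<mu> (\<rho> r p) t = 0"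
    if "p \<in> H" "t \<in> G" "r \<in> G" for p t r
    using compatible_G[OF that] G.mult_commute[of t "\<mu> p r"] that by simp
  have "fst (m (m (x, a) (y, b)) (z, c) + m (m (z, c) (x, a)) (y, b) + m (m (y, b) (z, c)) (x, a)) =
    ((x \<diamondop> y) \<diamondop> z + (z \<diamondop> x) \<diamondop> y + (y \<diamondop> z) \<diamondop> x) +
    (\<mu> c (x \<diamondop> y) + \<mu> c x \<diamondop> y + \<mu> c y \<diamondop> x + \<mu> (\<rho> x c) y + \<mu> (\<rho> y c) x) +
    (\<mu> b (z \<diamondop> x) + \<mu> b z \<diamondop> x + \<mu> b x \<diamondop> z + \<mu> (\<rho> z b) x + \<mu> (\<rho> x b) z) +
    (\<mu> a (y \<diamondop> z) + \<mu> a y \<diamondop> z + \<mu> a z \<diamondop> y + \<mu> (\<rho> y a) z + \<mu> (\<rho> z a) y) +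
    (\<mu> (a \<bullet> b) z + \<mu> a (\<mu> b z) + \<mu> b (\<mu> a z)) +
    (\<mu> (c \<bullet> a) y + \<mu> c (\<mu> a y) + \<mu> a (\<mu> c y)) +
    (\<mu> (b \<bullet> c) x + \<mu> b (\<mu> c x) + \<mu> c (\<mu> b x))"
    by (simp add: m_def bicrossed_mult_def G.mult_add_left \<mu>.act_add \<mu>.act_add_left add_ac)
  then show ?thesis
    by (simp add: G.jacobi comp rep)
qed

text \<open>The axioms are self-dual: exchanging the two algebras and their actions interchanges
  \<open>compatible_G\<close> and \<open>compatible_H\<close>.\<close>

lemma jj_matched_pair_swap:
  assumes "jj_matched_pair scaleG G multG scaleH H multH \<rho> \<mu>"
  shows "jj_matched_pair scaleH H multH scaleG G multG \<mu> \<rho>"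
proof -
  interpret jj_matched_pair scaleG G multG scaleH H multH \<rho> \<mu> by fact
  show ?thesis
    by unfold_locales (fact compatible_G compatible_H)+
qed

theorem jj_algebra_bicrossed:
  assumes "jj_matched_pair scaleG G multG scaleH H multH \<rho> \<mu>"
  shows "jj_algebra (module_prod.scale scaleG scaleH) (G \<times> H) (bicrossed_mult multG multH \<rho> \<mu>)"
proof -
  interpret jj_matched_pair scaleG G multG scaleH H multH \<rho> \<mu> by fact
  interpret swap: jj_matched_pair scaleH H multH scaleG G multG \<mu> \<rho>
    by (rule jj_matched_pair_swap) fact
  note vs = G.vector_space_axioms H.vector_space_axioms
  interpret P: vector_space "module_prod.scale scaleG scaleH"
    by (rule vector_space_module_prod[OF vs])
  define m where "m = bicrossed_mult multG multH \<rho> \<mu>"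
  note [simp] = G.mult_closed H.mult_closed \<rho>.act_closed \<mu>.act_closed
    G.subspace_add[OF G.subspace_carrier] H.subspace_add[OF H.subspace_carrier]
    G.subspace_scale[OF G.subspace_carrier] H.subspace_scale[OF H.subspace_carrier]
    G.subspace_0[OF G.subspace_carrier] H.subspace_0[OF H.subspace_carrier]
  have commute: "m u v = m v u" if "u \<in> G \<times> H" "v \<in> G \<times> H" for u v
    using that G.mult_commute[of "fst u" "fst v"] H.mult_commute[of "snd u" "snd v"]
    by (auto simp: m_def bicrossed_mult_def add_ac)
  have linear: "linear_between (module_prod.scale scaleG scaleH) (G \<times> H)
      (module_prod.scale scaleG scaleH) (G \<times> H) (m u)" if "u \<in> G \<times> H" for u
    using that
    by (intro linear_betweenI)
      (auto simp: m_def bicrossed_mult_def module_prod_scale[OF vs]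
        G.mult_add_right H.mult_add_right G.mult_scale_right H.mult_scale_right
        \<rho>.act_add \<mu>.act_add \<rho>.act_add_left \<mu>.act_add_left \<rho>.act_scale \<mu>.act_scale
        \<rho>.act_scale_left \<mu>.act_scale_left G.scale_right_distrib H.scale_right_distrib add_ac)
  show ?thesis
  proof
    show "P.subspace (G \<times> H)"
      by (auto simp: P.subspace_def module_prod_scale[OF vs] zero_prod_def)
    show "linear_between (module_prod.scale scaleG scaleH) (G \<times> H)
      (module_prod.scale scaleG scaleH) (G \<times> H) (bicrossed_mult multG multH \<rho> \<mu> u)"
      if "u \<in> G \<times> H" for u
      using linear[OF that] by (simp add: m_def)
    show "linear_between (module_prod.scale scaleG scaleH) (G \<times> H)
      (module_prod.scale scaleG scaleH) (G \<times> H) (\<lambda>u. bicrossed_mult multG multH \<rho> \<mu> u v)"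
      if "v \<in> G \<times> H" for v
    proof -
      \<comment> \<open>Linearity in the first argument is transported from the second by
        commutativity on the carrier.\<close>
      have "\<forall>u\<in>G \<times> H. m u v = m v u"
        using commute that by blast
      then show ?thesis
        using linear[OF that] by (auto simp: linear_between_def m_def module_prod_scale[OF vs])
    qed
    show "bicrossed_mult multG multH \<rho> \<mu> u v = bicrossed_mult multG multH \<rho> \<mu> v u"
      if "u \<in> G \<times> H" "v \<in> G \<times> H" for u v
      using commute[OF that] by (simp add: m_def)
    show "bicrossed_mult multG multH \<rho> \<mu> (bicrossed_mult multG multH \<rho> \<mu> u v) w +
        bicrossed_mult multG multH \<rho> \<mu> (bicrossed_mult multG multH \<rho> \<mu> w u) v +
        bicrossed_mult multG multH \<rho> \<mu> (bicrossed_mult multG multH \<rho> \<mu> v w) u = 0"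
      if "u \<in> G \<times> H" "v \<in> G \<times> H" "w \<in> G \<times> H" for u v w
    proof -
      obtain x a where u: "u = (x, a)" "x \<in> G" "a \<in> H" using \<open>u \<in> G \<times> H\<close> by auto
      obtain y b where v: "v = (y, b)" "y \<in> G" "b \<in> H" using \<open>v \<in> G \<times> H\<close> by auto
      obtain z c where w: "w = (z, c)" "z \<in> G" "c \<in> H" using \<open>w \<in> G \<times> H\<close> by auto
      \<comment> \<open>The swapped pair is applied to the triples with coordinates exchanged; its
        first component is the second component needed here.\<close>
      show ?thesis
        using bicrossed_jacobi_fst[of x y z a b c] swap.bicrossed_jacobi_fst[of a b c x y z] u v w
        by (intro prod_eqI) (simp_all add: bicrossed_mult_def)
    qed
  qed
qed

text \<open>The two actions are the components of the mixed product, so each law of \<open>m\<close>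
  on mixed elements splits into one statement about \<open>\<mu>\<close> and one about
  \<open>\<rho>\<close>. Bilinearity makes both actions bilinear, and the Jacobi identity supplies
  the rest.\<close>

theorem jj_matched_pair_of_product:
  assumes G: "jj_algebra scaleG G multG" and H: "jj_algebra scaleH H multH"
    and P: "jj_algebra (module_prod.scale scaleG scaleH) (G \<times> H) m"
    and mG: "\<And>x y. x \<in> G \<Longrightarrow> y \<in> G \<Longrightarrow> m (x, 0) (y, 0) = (multG x y, 0)"
    and mH: "\<And>a b. a \<in> H \<Longrightarrow> b \<in> H \<Longrightarrow> m (0, a) (0, b) = (0, multH a b)"
    and mGH: "\<And>x a. x \<in> G \<Longrightarrow> a \<in> H \<Longrightarrow> m (x, 0) (0, a) = (\<mu> a x, \<rho> x a)"
  shows "jj_matched_pair scaleG G multG scaleH H multH \<rho> \<mu>"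
proof -
  interpret G: jj_algebra scaleG G multG by fact
  interpret H: jj_algebra scaleH H multH by fact
  interpret P: jj_algebra "module_prod.scale scaleG scaleH" "G \<times> H" m by fact
  note vs = G.vector_space_axioms H.vector_space_axioms
  note [simp] = G.subspace_0[OF G.subspace_carrier] H.subspace_0[OF H.subspace_carrier]
    G.mult_closed H.mult_closed
  have mHG: "m (0, a) (x, 0) = (\<mu> a x, \<rho> x a)" if "x \<in> G" "a \<in> H" for x a
    using P.mult_commute[of "(0, a)" "(x, 0)"] mGH that by simp
  have closed: "\<mu> a x \<in> G \<and> \<rho> x a \<in> H" if "x \<in> G" "a \<in> H" for x a
    using P.mult_closed[of "(x, 0)" "(0, a)"] mGH that by simp
  note [simp] = closed[THEN conjunct1] closed[THEN conjunct2]
  \<comment> \<open>In the Jacobi sum a mixed product is an element with two components that is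
    multiplied again by a pure one; this rule and \<open>mR\<close> evaluate the outer
    product.\<close>
  have mL: "m (x, a) (y, 0) = (multG x y + \<mu> a y, \<rho> y a)" if "x \<in> G" "a \<in> H" "y \<in> G" for x a y
    using P.mult_add_left[of "(x, 0)" "(0, a)" "(y, 0)"] mG mHG that by simp
  have mR: "m (x, a) (0, b) = (\<mu> b x, \<rho> x b + multH a b)" if "x \<in> G" "a \<in> H" "b \<in> H" for x a b
    using P.mult_add_left[of "(x, 0)" "(0, a)" "(0, b)"] mH mGH that by simp
  have add_a: "\<mu> (a + b) x = \<mu> a x + \<mu> b x \<and> \<rho> x (a + b) = \<rho> x a + \<rho> x b"
    if "x \<in> G" "a \<in> H" "b \<in> H" for x a b
    using P.mult_add_right[of "(0, a)" "(0, b)" "(x, 0)"] that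
      H.subspace_add[OF H.subspace_carrier, of a b] by (simp add: mGH)
  have add_x: "\<mu> a (x + y) = \<mu> a x + \<mu> a y \<and> \<rho> (x + y) a = \<rho> x a + \<rho> y a"
    if "x \<in> G" "y \<in> G" "a \<in> H" for x y a
    using P.mult_add_left[of "(x, 0)" "(y, 0)" "(0, a)"] that
      G.subspace_add[OF G.subspace_carrier, of x y] by (simp add: mGH)
  have scale_a: "\<mu> (scaleH c a) x = scaleG c (\<mu> a x) \<and> \<rho> x (scaleH c a) = scaleH c (\<rho> x a)"
    if "x \<in> G" "a \<in> H" for x a c
    using P.mult_scale_right[of "(x, 0)" "(0, a)" c] that
      H.subspace_scale[OF H.subspace_carrier, of a c] by (simp add: mGH module_prod_scale[OF vs])
  have scale_x: "\<mu> a (scaleG c x) = scaleG c (\<mu> a x) \<and> \<rho> (scaleG c x) a = scaleH c (\<rho> x a)"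
    if "x \<in> G" "a \<in> H" for x a c
    using P.mult_scale_left[of "(x, 0)" "(0, a)" c] that
      G.subspace_scale[OF G.subspace_carrier, of x c] by (simp add: mGH module_prod_scale[OF vs])
  \<comment> \<open>The first component is compatibility on \<open>G\<close>, the second the
    representation law of \<open>\<rho>\<close>. In \<open>jac_H\<close> below the roles are
    reversed: representation law of \<open>\<mu>\<close> first, compatibility on \<open>H\<close>
    second.\<close>
  have jac_G: "(\<mu> a (multG x y) + (multG (\<mu> a x) y + \<mu> (\<rho> x a) y) +
        (multG (\<mu> a y) x + \<mu> (\<rho> y a) x),
      \<rho> (multG x y) a + \<rho> y (\<rho> x a) + \<rho> x (\<rho> y a)) = (0, 0)"
    if "x \<in> G" "y \<in> G" "a \<in> H" for x y a
    using P.jacobi[of "(x, 0)" "(y, 0)" "(0, a)"] that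
    by (simp add: mG mGH mHG mL[of "\<mu> a x" "\<rho> x a" y] mL[of "\<mu> a y" "\<rho> y a" x] zero_prod_def)
  have jac_H: "(\<mu> (multH a b) x + \<mu> b (\<mu> a x) + \<mu> a (\<mu> b x),
      \<rho> x (multH a b) + (\<rho> (\<mu> a x) b + multH (\<rho> x a) b) + (\<rho> (\<mu> b x) a + multH (\<rho> x b) a)) = (0, 0)"
    if "x \<in> G" "a \<in> H" "b \<in> H" for x a b
    using P.jacobi[of "(0, a)" "(0, b)" "(x, 0)"] that
    by (simp add: mH mGH mHG mR[of "\<mu> a x" "\<rho> x a" b] mR[of "\<mu> b x" "\<rho> x b" a] zero_prod_def)
  show ?thesis
  proof unfold_locales
    show "linear_between scaleH H scaleH H (\<rho> x)" if "x \<in> G" for x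
      using that by (intro linear_betweenI) (simp_all add: add_a scale_a)
    show "linear_between scaleG G scaleH H (\<lambda>x. \<rho> x a)" if "a \<in> H" for a
      using that by (intro linear_betweenI) (simp_all add: add_x scale_x)
    show "linear_between scaleG G scaleG G (\<mu> a)" if "a \<in> H" for a
      using that by (intro linear_betweenI) (simp_all add: add_x scale_x)
    show "linear_between scaleH H scaleG G (\<lambda>a. \<mu> a x)" if "x \<in> G" for x
      using that by (intro linear_betweenI) (simp_all add: add_a scale_a)
    show "\<rho> (multG x y) a = - \<rho> x (\<rho> y a) - \<rho> y (\<rho> x a)" if "x \<in> G" "y \<in> G" "a \<in> H" for x y a
      using jac_G[OF that] by (simp add: eq_neg_iff_add_eq_0 eq_diff_eq add_ac)
    show "\<mu> (multH a b) x = - \<mu> a (\<mu> b x) - \<mu> b (\<mu> a x)" if "a \<in> H" "b \<in> H" "x \<in> G" for a b x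
      using jac_H[of x a b] that by (simp add: eq_neg_iff_add_eq_0 eq_diff_eq add_ac)
    show "\<rho> x (multH a b) + multH (\<rho> x a) b + multH a (\<rho> x b) + \<rho> (\<mu> a x) b + \<rho> (\<mu> b x) a = 0"
      if "x \<in> G" "a \<in> H" "b \<in> H" for x a b
      using jac_H[OF that] H.mult_commute[of a "\<rho> x b"] that by (simp add: add_ac)
    show "\<mu> a (multG x y) + multG (\<mu> a x) y + multG x (\<mu> a y) + \<mu> (\<rho> x a) y + \<mu> (\<rho> y a) x = 0"
      if "a \<in> H" "x \<in> G" "y \<in> G" for a x y
      using jac_G[of x y a] G.mult_commute[of x "\<mu> a y"] that by (simp add: add_ac)
  qed (fact G.subspace_carrier H.subspace_carrier)+
qed

section \<open>Double constructions and the coadjoint-type actions\<close>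

theorem theorem4p2:
  fixes s :: "'k::field \<Rightarrow> 'v::ab_group_add \<Rightarrow> 'v"
    and Basis :: "'v set"
    and mult :: "'v \<Rightarrow> 'v \<Rightarrow> 'v"
    and multD :: "('v \<Rightarrow> 'k) \<Rightarrow> ('v \<Rightarrow> 'k) \<Rightarrow> ('v \<Rightarrow> 'k)"
  assumes "CHAR('k) \<noteq> 2" and "CHAR('k) \<noteq> 3"
    and "finite_dimensional_vector_space s Basis"
    and "jj_algebra s UNIV mult"
    and "jj_algebra scale_dual (dual s) multD"
  shows "(\<exists>m. double_construction s mult multD m) \<longleftrightarrow>
    jj_matched_pair s UNIV mult scale_dual (dual s) multD
      (Lstar mult) (Lstar_dual s multD)"
proof -
  interpret G: jj_algebra s UNIV mult by fact
  interpret H: jj_algebra scale_dual "dual s" multD by fact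
  note unique = Lstar_dual_unique[OF assms(3,5)]
  note dual = dual_iff[OF G.vector_space_axioms]
  have dual_zero: "u 0 = 0" if "u \<in> dual s" for u :: "'v \<Rightarrow> 'k"
    using that[unfolded dual] G.scale_zero_left[of 0] mult_zero_left by metis
  have zero_dual: "0 \<in> dual s"
    by (rule H.subspace_0[OF H.subspace_carrier])
  \<comment> \<open>Finite dimension enters through \<open>unique\<close>: exactly one vector
    represents the functional, so the definite description has its defining property.\<close>
  have pair: "b (Lstar_dual s multD a x) = multD a b x" if "a \<in> dual s" "b \<in> dual s" for a b x
    using theI'[OF unique[OF that(1)], of x] that(2) by (simp add: Lstar_dual_def)
  show ?thesis
  proof
    assume "\<exists>m. double_construction s mult multD m"
    then obtain m where
      P: "jj_algebra (module_prod.scale s scale_dual) (UNIV \<times> dual s) m" and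
      mG: "m (x, 0) (y, 0) = (mult x y, 0)" and
      mH: "a \<in> dual s \<Longrightarrow> b \<in> dual s \<Longrightarrow> m (0, a) (0, b) = (0, multD a b)" and
      inv: "u \<in> UNIV \<times> dual s \<Longrightarrow> v \<in> UNIV \<times> dual s \<Longrightarrow> w \<in> UNIV \<times> dual s \<Longrightarrow>
        double_form (m u v) w = double_form u (m v w)" for x y a b u v w
      unfolding double_construction_def Let_def by blast
    interpret P: jj_algebra "module_prod.scale s scale_dual" "UNIV \<times> dual s" m by fact
    show "jj_matched_pair s UNIV mult scale_dual (dual s) multD (Lstar mult) (Lstar_dual s multD)"
    proof (rule jj_matched_pair_of_product[OF assms(4,5) P mG mH])
      fix x a assume a: "a \<in> dual s"
      define p where "p = m (x, 0) (0, a)"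
      have p: "snd p \<in> dual s"
        using P.mult_closed[of "(x, 0)" "(0, a)"] a zero_dual by (auto simp: p_def)
      have p': "p = m (0, a) (x, 0)"
        using P.mult_commute[of "(x, 0)" "(0, a)"] a zero_dual by (simp add: p_def)
      \<comment> \<open>Pairing with a vector isolates the dual component. Writing the functional as
        left factor, as in \<open>p'\<close>, invariance reads B(a * x, y) = B(a, x * y), whose
        right side involves only the known product of two vectors.\<close>
      have "snd p y = a (mult x y)" for y
        using inv[of "(0, a)" "(x, 0)" "(y, 0)"] a zero_dual
        by (simp add: p'[symmetric] mG double_form_def)
      then have "snd p = Lstar mult x a"
        by (auto simp: Lstar_def)
      \<comment> \<open>Dually, B(x * a, b) = B(x, a * b) isolates the vector component; the
        leftover term \<open>snd p 0\<close> vanishes by \<open>dual_zero\<close>.\<close>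
      moreover have "b (fst p) = multD a b x" if "b \<in> dual s" for b
        using inv[of "(x, 0)" "(0, a)" "(0, b)"] a that zero_dual dual_zero[OF p]
        by (simp add: p_def[symmetric] mH double_form_def)
      then have "Lstar_dual s multD a x = fst p"
        unfolding Lstar_dual_def using unique[OF a, of x] by (intro the1_equality) auto
      ultimately show "m (x, 0) (0, a) = (Lstar_dual s multD a x, Lstar mult x a)"
        by (simp add: p_def prod_eq_iff)
    qed auto
  next
    assume M: "jj_matched_pair s UNIV mult scale_dual (dual s) multD (Lstar mult) (Lstar_dual s multD)"
    interpret M: jj_matched_pair s UNIV mult scale_dual "dual s" multD "Lstar mult" "Lstar_dual s multD"
      by fact
    let ?m = "bicrossed_mult mult multD (Lstar mult) (Lstar_dual s multD)"
    have "double_form (?m u v) w = double_form u (?m v w)"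
      if "u \<in> UNIV \<times> dual s" "v \<in> UNIV \<times> dual s" "w \<in> UNIV \<times> dual s" for u v w
    proof -
      obtain x a y b z c where uvw: "u = (x, a)" "v = (y, b)" "w = (z, c)"
        by (metis prod.collapse)
      have D: "a \<in> dual s" "b \<in> dual s" "c \<in> dual s"
        using that uvw by auto
      then have add: "a (p + q) = a p + a q" "c (p + q) = c p + c q" for p q
        by (simp_all add: dual)
      \<comment> \<open>By \<open>pair\<close> and \<open>Lstar_def\<close>, both sides become
        \<open>a (mult y z) + b (mult x z) + c (mult x y) + multD a b z + multD a c y + multD b c
        x\<close>, up to commutativity of the two products.\<close>
      show ?thesis
        using D H.mult_commute[of a b] H.mult_commute[of a c] G.mult_commute[of x y] G.mult_commute[of x z]
        by (simp add: uvw bicrossed_mult_def double_form_def add pair Lstar_def add_ac)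
    qed
    \<comment> \<open>On two vectors or two functionals every action term has a zero argument, so
      \<open>?m\<close> restricts to the given products.\<close>
    then have "double_construction s mult multD ?m"
      using jj_algebra_bicrossed[OF M]
      by (auto simp: double_construction_def bicrossed_mult_def zero_dual G.mult_zero_left
        G.mult_zero_right H.mult_zero_left H.mult_zero_right M.\<rho>.act_zero M.\<rho>.act_zero_left
        M.\<mu>.act_zero M.\<mu>.act_zero_left)
    then show "\<exists>m. double_construction s mult multD m"
      by (rule exI[of _ ?m])
  qed
qed

end
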